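(* Let $K$ be a compact Hausdorff space, let $A$ be a uniform algebra on $K$, and let $\Gamma$ be the Shilov boundary of $A$. Then for $f\in S_A$ (i.e. $f\in A$ with $\|f\|_\infty=1$), the following are equivalent: (i) $f$ is a Daugavet point (of $A$); (ii) $f$ is a $\Delta$-point (of $A$); (iii) there is a limit point $t_0$ of $\Gamma$ such that $\|f\|_\infty=|f(t_0)|$.
   Context: A uniform algebra on a compact Hausdorff space $K$ is a closed subalgebra of $C(K)$ (complex-valued, supremum norm) that separates the points of $K$ and contains the constant functions. A boundary for $A$ is a set $S\subset K$ such that for every $\phi\in A$ there is $t\in S$ with $|\phi(t)|=\|\phi\|_\infty$; the Shilov boundary of $A$ is the smallest closed boundary of $A$. For a Banach space $Z$ with closed unit ball $B_Z$ and unit sphere $S_Z$, $z\in S_Z$ and $\epsilon>0$, let $\Delta_\epsilon(z)=\{y\in B_Z:\|z-y\|\ge 2-\epsilon\}$. A point $z\in S_Z$ is a $\Delta$-point if $z\in\overline{\mathrm{conv}}\,\Delta_\epsilon(z)$ for every $\epsilon>0$, and a Daugavet point if $B_Z=\overline{\mathrm{conv}}\,\Delta_\epsilon(z)$ for every $\epsilon>0$. *)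

theory Defs
  imports "HOL-Analysis.Analysis"
begin

(* For a compact space 'a, the type 'a \<Rightarrow>\<^sub>C complex of bounded continuous functions
   is C(K) with the supremum norm.  The library gives it only its real normed space structure. *)

definition times_bcontfun ::
    "('a::topological_space \<Rightarrow>\<^sub>C complex) \<Rightarrow> ('a \<Rightarrow>\<^sub>C complex) \<Rightarrow> ('a \<Rightarrow>\<^sub>C complex)" where
  "times_bcontfun f g = Bcontfun (\<lambda>x. apply_bcontfun f x * apply_bcontfun g x)"

lemma apply_times_bcontfun [simp]:
  "apply_bcontfun (times_bcontfun f g) x = apply_bcontfun f x * apply_bcontfun g x"
proof -
  obtain a b where a: "\<And>x. norm (apply_bcontfun f x) \<le> a" and b: "\<And>x. norm (apply_bcontfun g x) \<le> b"
    using bounded_apply_bcontfun[of f] bounded_apply_bcontfun[of g] unfolding bounded_iff by blast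
  have "norm (apply_bcontfun f x * apply_bcontfun g x) \<le> a * b" for x
    unfolding norm_mult by (intro mult_mono' a b norm_ge_zero)
  then have "bounded (range (\<lambda>x. apply_bcontfun f x * apply_bcontfun g x))"
    unfolding bounded_iff by blast
  then have "(\<lambda>x. apply_bcontfun f x * apply_bcontfun g x) \<in> bcontfun"
    by (auto simp: bcontfun_def intro: continuous_on_mult)
  then show ?thesis
    by (simp add: times_bcontfun_def Bcontfun_inverse)
qed

(* Closure under multiplication by complex scalars is the closure under products
   with constant functions. *)
definition uniform_algebra :: "('a::topological_space \<Rightarrow>\<^sub>C complex) set \<Rightarrow> bool" where
  "uniform_algebra A \<longleftrightarrow>
     closed A \<and>
     (\<forall>c. const_bcontfun c \<in> A) \<and>
     (\<forall>f\<in>A. \<forall>g\<in>A. f + g \<in> A) \<and>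
     (\<forall>f\<in>A. \<forall>g\<in>A. times_bcontfun f g \<in> A) \<and>
     (\<forall>s t. s \<noteq> t \<longrightarrow> (\<exists>f\<in>A. apply_bcontfun f s \<noteq> apply_bcontfun f t))"

definition boundary_for :: "('a::topological_space \<Rightarrow>\<^sub>C complex) set \<Rightarrow> 'a set \<Rightarrow> bool" where
  "boundary_for A S \<longleftrightarrow> (\<forall>\<phi>\<in>A. \<exists>t\<in>S. norm (apply_bcontfun \<phi> t) = norm \<phi>)"

(* Sets are ordered by inclusion.  For a uniform algebra on a compact Hausdorff space
   the least closed boundary exists by Shilov's theorem. *)
definition shilov_boundary :: "('a::topological_space \<Rightarrow>\<^sub>C complex) set \<Rightarrow> 'a set" where
  "shilov_boundary A = (LEAST S. closed S \<and> boundary_for A S)"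

(* Below, the Banach space Z is given as a closed subspace of an ambient normed space,
   with the induced norm; being closed, it contains the closures taken in the ambient space. *)

definition Delta_set :: "'z::real_normed_vector set \<Rightarrow> real \<Rightarrow> 'z \<Rightarrow> 'z set" where
  "Delta_set Z \<epsilon> z = {y \<in> Z. norm y \<le> 1 \<and> norm (z - y) \<ge> 2 - \<epsilon>}"

definition Delta_point :: "'z::real_normed_vector set \<Rightarrow> 'z \<Rightarrow> bool" where
  "Delta_point Z z \<longleftrightarrow> z \<in> Z \<and> norm z = 1 \<and>
     (\<forall>\<epsilon>>0. z \<in> closure (convex hull (Delta_set Z \<epsilon> z)))"

definition Daugavet_point :: "'z::real_normed_vector set \<Rightarrow> 'z \<Rightarrow> bool" where
  "Daugavet_point Z z \<longleftrightarrow> z \<in> Z \<and> norm z = 1 \<and>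
     (\<forall>\<epsilon>>0. {y \<in> Z. norm y \<le> 1} = closure (convex hull (Delta_set Z \<epsilon> z)))"

end

theory Submission
  imports Defs
begin

text \<open>Write \<open>\<Gamma>\<close> for the Shilov boundary.  Suppose \<open>t\<^sub>0\<close> is a limit point of \<open>\<Gamma>\<close> with
  \<open>c = f(t\<^sub>0)\<close> of modulus 1, and let \<open>g\<close> be in the unit ball.  Choose many disjoint open sets \<open>U\<^sub>i\<close>
  near \<open>t\<^sub>0\<close> that meet \<open>\<Gamma>\<close>, and \<open>h\<^sub>i \<in> A\<close> with value 1 somewhere in \<open>U\<^sub>i\<close>, small on \<open>\<Gamma> - U\<^sub>i\<close>
  and with \<open>|h\<^sub>i| + |1 - h\<^sub>i| \<le> 1 + \<delta>\<close>.  Then \<open>(1 - h\<^sub>i) g - c h\<^sub>i\<close> has norm at most \<open>1 + \<delta>\<close> and is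
  almost antipodal to \<open>f\<close>, and the average over \<open>i\<close> is close to \<open>g\<close> because the \<open>U\<^sub>i\<close> are disjoint.
  The values of \<open>h\<^sub>i\<close> lie near the segment from 0 to 1; instead of a conformal map onto a thin
  domain, \<open>h\<^sub>i\<close> is an average of very lacunary powers of \<open>(1 + p) / 2\<close> with \<open>p\<close> peaking in \<open>U\<^sub>i\<close>.

  The existence of the least closed boundary is Bear's argument: a basic open set
  \<open>|g\<^sub>1| < 1, \<dots>, |g\<^sub>n| < 1\<close> disjoint from some boundary can be removed from every closed
  boundary, so by compactness the intersection of all closed boundaries is a boundary.\<close>

section \<open>Lacunary powers in the disc\<close>

lemma norm_one_minus_power_le:
  fixes w :: complex
  assumes "norm w \<le> 1"
  shows "norm (1 - w ^ m) \<le> real m * norm (1 - w)"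
  using norm_power_diff[of 1 w m] assms by simp

text \<open>The first hypothesis places \<open>w\<close> in the disc with diameter [0, 1]. With q =
  |1 - w|^2 it gives |w|^(2m) \<le> (1 - q)^m, and Bernoulli's inequality together with (1 - q)(1 +
  q) \<le> 1 gives (1 - q)^m \<le> 1 / (m q) \<le> \<delta>^2.\<close>

lemma norm_power_le_of_disc:
  fixes w :: complex
  assumes w: "(norm w)\<^sup>2 + (norm (1 - w))\<^sup>2 \<le> 1"
    and \<delta>: "0 < \<delta>" and m: "1 \<le> real m * \<delta>\<^sup>2 * (norm (1 - w))\<^sup>2"
  shows "norm (w ^ m) \<le> \<delta>"
proof -
  define q where "q = (norm (1 - w))\<^sup>2"
  have q: "0 \<le> q" "q \<le> 1"
    using w by (auto simp: q_def intro: order_trans[rotated])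
  have "(norm (w ^ m))\<^sup>2 = ((norm w)\<^sup>2) ^ m"
    by (simp add: norm_power power_mult[symmetric] mult.commute)
  also have "\<dots> \<le> (1 - q) ^ m"
    using w by (intro power_mono) (auto simp: q_def)
  finally have 1: "(norm (w ^ m))\<^sup>2 \<le> (1 - q) ^ m" .
  have "(1 - q) ^ m * (real m * q) \<le> (1 - q) ^ m * (1 + q) ^ m"
    using q Bernoulli_inequality[of q m] by (intro mult_left_mono) auto
  also have "\<dots> = ((1 - q) * (1 + q)) ^ m"
    by (simp add: power_mult_distrib)
  also have "\<dots> \<le> 1"
    using q by (intro power_le_one) (auto simp: algebra_simps mult_le_one)
  finally have 2: "(1 - q) ^ m * (real m * q) \<le> 1" .
  have "(1 - q) ^ m \<le> (1 - q) ^ m * (real m * \<delta>\<^sup>2 * q)"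
    using m q by (simp add: q_def mult_le_cancel_left1 zero_le_power)
  also have "\<dots> = ((1 - q) ^ m * (real m * q)) * \<delta>\<^sup>2"
    by simp
  also have "\<dots> \<le> 1 * \<delta>\<^sup>2"
    using 2 by (intro mult_right_mono) auto
  finally have "(norm (w ^ m))\<^sup>2 \<le> \<delta>\<^sup>2"
    using 1 by simp
  then show ?thesis
    using \<delta> by (simp add: power2_le_iff_abs_le)
qed

text \<open>The gaps are quadratic because \<open>w ^ m\<close> is near 1 while m |1 - w| \<le>
  \<delta>, but guaranteed to be small only once m |1 - w|^2 \<ge> 1 / \<delta>^2. Squaring the
  previous term and multiplying by \<open>L\<close> > 1 / \<delta>^4 suffices.\<close>

lemma lacunary_sequence_exists:
  fixes \<delta> :: real
  assumes "0 < \<delta>"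
  shows "\<exists>m :: nat \<Rightarrow> nat. (\<forall>k. M \<le> m k) \<and>
    (\<forall>k l. k < l \<longrightarrow> (real (m k))\<^sup>2 \<le> \<delta> ^ 4 * real (m l))"
proof -
  obtain L :: nat where L0: "1 / \<delta> ^ 4 < real L"
    using reals_Archimedean2 by blast
  have "0 < 1 / \<delta> ^ 4"
    using assms by simp
  then have "0 < real L"
    using L0 by linarith
  then have L: "1 \<le> L" "1 \<le> \<delta> ^ 4 * real L"
    using L0 assms by (auto simp: field_simps)
  \<comment> \<open>Starting at 1 or more keeps every term positive, so squaring never decreases
    it.\<close>
  define m where "m = rec_nat (max 1 M) (\<lambda>_ x. x\<^sup>2 * L)"
  have m0: "m 0 = max 1 M" and mS: "m (Suc k) = (m k)\<^sup>2 * L" for k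
    by (auto simp: m_def)
  have pos: "1 \<le> m k" for k
    using L(1) by (induction k) (auto simp: m0 mS)
  have step: "m k \<le> m (Suc k)" for k
    using mult_le_mono[OF mult_le_mono2[OF pos[of k], of "m k"] L(1)]
    by (simp add: mS power2_eq_square)
  have mono: "k \<le> l \<Longrightarrow> m k \<le> m l" for k l
    using step by (rule lift_Suc_mono_le)
  show ?thesis
  proof (intro exI[of _ m] conjI allI impI)
    show "M \<le> m k" for k
      using mono[of 0 k] by (simp add: m0)
    show "(real (m k))\<^sup>2 \<le> \<delta> ^ 4 * real (m l)" if "k < l" for k l
    proof -
      have "(real (m k))\<^sup>2 * 1 \<le> (real (m k))\<^sup>2 * (\<delta> ^ 4 * real L)"
        using L(2) by (intro mult_left_mono) auto
      also have "\<dots> = \<delta> ^ 4 * real (m (Suc k))"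
        by (simp add: mS)
      also have "\<dots> \<le> \<delta> ^ 4 * real (m l)"
        using mono[of "Suc k" l] that by (intro mult_left_mono) auto
      finally show ?thesis by simp
    qed
  qed
qed

text \<open>For each point w of the disc at most one of the powers is close neither to 0 nor to 1,
  so their average maps the disc into a thin neighbourhood of the segment from 0 to 1.\<close>

lemma lacunary_powers_near_segment:
  fixes w :: complex and m :: "nat \<Rightarrow> nat"
  assumes w: "(norm w)\<^sup>2 + (norm (1 - w))\<^sup>2 \<le> 1"
    and \<delta>: "0 < \<delta>"
    and m: "\<And>k l. k < l \<Longrightarrow> (real (m k))\<^sup>2 \<le> \<delta> ^ 4 * real (m l)"
  shows "(\<Sum>k<N. norm (w ^ m k) + norm (1 - w ^ m k)) \<le> real N * (1 + 2 * \<delta>) + 2"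
proof -
  define r where "r = norm (1 - w)"
  have "(norm w)\<^sup>2 \<le> 1\<^sup>2"
    using w by (smt (verit) zero_le_power2 one_power2)
  then have w1: "norm w \<le> 1"
    by (rule power2_le_imp_le) simp
  \<comment> \<open>\<open>B\<close> holds the exponents too large for the estimate near 1 and too
    small for the estimate near 0.\<close>
  define B where "B = {k. k < N \<and> \<delta> < real (m k) * r \<and> real (m k) * \<delta>\<^sup>2 * r\<^sup>2 < 1}"
  \<comment> \<open>By lacunarity, two such exponents would give \<delta>^4 < m(k)^2 r^2 \<delta>^2
    \<le> \<delta>^4 m(l) \<delta>^2 r^2 \<le> \<delta>^4.\<close>
  have no_two: False if "k \<in> B" "l \<in> B" "k < l" for k l
  proof -
    have "\<delta>\<^sup>2 * \<delta>\<^sup>2 < (real (m k) * r)\<^sup>2 * \<delta>\<^sup>2"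
      using that(1) \<delta> by (intro mult_strict_right_mono power_strict_mono) (auto simp: B_def)
    also have "\<dots> = (real (m k))\<^sup>2 * (r\<^sup>2 * \<delta>\<^sup>2)"
      by (simp add: power_mult_distrib)
    also have "\<dots> \<le> (\<delta> ^ 4 * real (m l)) * (r\<^sup>2 * \<delta>\<^sup>2)"
      by (intro mult_right_mono m that) auto
    also have "\<dots> = \<delta> ^ 4 * (real (m l) * \<delta>\<^sup>2 * r\<^sup>2)"
      by simp
    also have "\<dots> \<le> \<delta> ^ 4 * 1"
      using that(2) \<delta> by (intro mult_left_mono) (auto simp: B_def)
    finally show False
      by (simp add: power2_eq_square power4_eq_xxxx mult.assoc)
  qed
  have finB: "finite B"
    by (simp add: B_def)
  have cardB: "card B \<le> 1"
    using no_two finB by (metis card_le_Suc0_iff_eq linorder_neqE_nat One_nat_def)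
  \<comment> \<open>A power within \<delta> of 0 or of 1 costs at most 1 + 2\<delta>. Any other
    costs at most 3, hence the surplus 2 on \<open>B\<close>.\<close>
  have "(\<Sum>k<N. norm (w ^ m k) + norm (1 - w ^ m k))
      \<le> (\<Sum>k<N. (1 + 2 * \<delta>) + (if k \<in> B then 2 else 0))"
  proof (rule sum_mono)
    fix k assume k: "k \<in> {..<N}"
    have a: "norm (w ^ m k) \<le> 1"
      using w1 by (simp add: norm_power power_le_one)
    have b: "norm (1 - w ^ m k) \<le> 1 + norm (w ^ m k)" "norm (w ^ m k) \<le> 1 + norm (1 - w ^ m k)"
      using norm_triangle_ineq4[of 1 "w ^ m k"] norm_triangle_ineq4[of 1 "1 - w ^ m k"] by auto
    consider "k \<in> B" | "real (m k) * r \<le> \<delta>" | "1 \<le> real (m k) * \<delta>\<^sup>2 * r\<^sup>2"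
      using k by (force simp: B_def)
    then show "norm (w ^ m k) + norm (1 - w ^ m k)
        \<le> (1 + 2 * \<delta>) + (if k \<in> B then 2 else 0)"
    proof cases
      case 1
      then show ?thesis using a b \<delta> by simp
    next
      case 2
      then have "norm (1 - w ^ m k) \<le> \<delta>"
        using norm_one_minus_power_le[OF w1, of "m k"] by (simp add: r_def)
      then show ?thesis using b \<delta> by auto
    next
      case 3
      then have "norm (w ^ m k) \<le> \<delta>"
        using norm_power_le_of_disc[OF w \<delta>] by (simp add: r_def)
      then show ?thesis using b \<delta> by auto
    qed
  qed
  also have "\<dots> = real N * (1 + 2 * \<delta>) + 2 * real (card B)"
  proof -
    have "(\<Sum>k<N. if k \<in> B then 2 else (0::real)) = (\<Sum>k\<in>B. 2)"
      by (rule sum.mono_neutral_cong_right) (auto simp: B_def)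
    then show ?thesis
      by (simp add: sum.distrib)
  qed
  also have "\<dots> \<le> real N * (1 + 2 * \<delta>) + 2"
    using cardB by simp
  finally show ?thesis .
qed

section \<open>Disjoint families of sets\<close>

text \<open>Only one index can have \<open>s\<close> in its set; it accounts for \<open>b\<close>,
  the others for \<open>d\<close>. This later makes the average of the peaking functions
  small.\<close>

lemma sum_le_of_disjoint_family:
  fixes a :: "nat \<Rightarrow> real"
  assumes disj: "disjoint_family_on U {..<N}"
    and a: "\<And>i. i < N \<Longrightarrow> a i \<le> b" "\<And>i. i < N \<Longrightarrow> s \<notin> U i \<Longrightarrow> a i \<le> d"
    and "0 \<le> b" "0 \<le> d"
  shows "(\<Sum>i<N. a i) \<le> b + real N * d"
proof (cases "\<exists>j<N. s \<in> U j")
  case True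
  then obtain j where j: "j < N" "s \<in> U j" by blast
  have "(\<Sum>i<N. a i) \<le> (\<Sum>i<N. (if i = j then b else 0) + d)"
  proof (rule sum_mono)
    fix i assume i: "i \<in> {..<N}"
    have "s \<notin> U i" if "i \<noteq> j"
      using disj j i that by (auto simp: disjoint_family_on_def)
    then show "a i \<le> (if i = j then b else 0) + d"
      using a i assms(4,5) by (auto intro: add_increasing2)
  qed
  also have "\<dots> = b + real N * d"
    using j by (simp add: sum.distrib)
  finally show ?thesis .
next
  case False
  then have "(\<Sum>i<N. a i) \<le> (\<Sum>i<N. d)"
    by (intro sum_mono a) auto
  then show ?thesis
    using assms(4) by simp
qed

text \<open>Pick a point of \<open>S\<close> in \<open>V\<close> other than the limit point and
  separate the two: the neighbourhood of the former is the new member, and the others are built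
  inside the neighbourhood of the latter. Hence the induction over arbitrary
  \<open>V\<close>.\<close>

lemma islimpt_disjoint_open_family:
  fixes t\<^sub>0 :: "'a::t2_space"
  assumes "t\<^sub>0 islimpt S" "open V" "t\<^sub>0 \<in> V"
  obtains U where "disjoint_family_on U {..<N::nat}"
    "\<And>i. i < N \<Longrightarrow> open (U i) \<and> U i \<subseteq> V \<and> S \<inter> U i \<noteq> {}"
proof -
  have "\<exists>U. disjoint_family_on U {..<N::nat} \<and>
      (\<forall>i<N. open (U i) \<and> U i \<subseteq> V \<and> S \<inter> U i \<noteq> {})"
    using assms(2,3)
  proof (induction N arbitrary: V)
    case 0
    then show ?case by (auto simp: disjoint_family_on_def)
  next
    case (Suc N)
    obtain s where s: "s \<in> S" "s \<in> V" "s \<noteq> t\<^sub>0"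
      using islimptE[OF assms(1) Suc.prems(2,1)] by blast
    obtain P Q where PQ: "open P" "open Q" "s \<in> P" "t\<^sub>0 \<in> Q" "P \<inter> Q = {}"
      using hausdorff[OF s(3)] by blast
    obtain U where U: "disjoint_family_on U {..<N}"
      "\<And>i. i < N \<Longrightarrow> open (U i) \<and> U i \<subseteq> V \<inter> Q \<and> S \<inter> U i \<noteq> {}"
      using Suc.IH[of "V \<inter> Q"] PQ Suc.prems by blast
    define U' where "U' = U(N := V \<inter> P)"
    have "disjoint_family_on U' {..<Suc N}"
      using U PQ(5) unfolding disjoint_family_on_def U'_def
      by (auto simp: less_Suc_eq) blast+
    moreover have "open (U' i) \<and> U' i \<subseteq> V \<and> S \<inter> U' i \<noteq> {}" if "i < Suc N" for i
      using U(2)[of i] that PQ s Suc.prems by (auto simp: U'_def less_Suc_eq)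
    ultimately show ?case by blast
  qed
  then show thesis using that by blast
qed

section \<open>The Shilov boundary\<close>

lemma bounded_linear_apply_bcontfun:
  "bounded_linear (\<lambda>f :: 'a::topological_space \<Rightarrow>\<^sub>C 'b::real_normed_vector. apply_bcontfun f t)"
  by (rule bounded_linear_intro[of _ 1]) (auto simp: norm_bounded)

lemma apply_bcontfun_sum:
  "apply_bcontfun (\<Sum>i\<in>I. f i) t = (\<Sum>i\<in>I. apply_bcontfun (f i) t)"
  for f :: "'i \<Rightarrow> 'a::topological_space \<Rightarrow>\<^sub>C 'b::real_normed_vector"
  by (induction I rule: infinite_finite_induct) auto

section \<open>Algebraic closure and norm attainment in a uniform algebra\<close>

locale compact_uniform_algebra =
  fixes A :: "('a::t2_space \<Rightarrow>\<^sub>C complex) set"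
  assumes compact_UNIV: "compact (UNIV :: 'a set)"
    and uniform_algebra: "uniform_algebra A"
begin

lemma closed_A: "closed A"
  and const_in: "const_bcontfun c \<in> A"
  and add_in: "f \<in> A \<Longrightarrow> g \<in> A \<Longrightarrow> f + g \<in> A"
  and times_in: "f \<in> A \<Longrightarrow> g \<in> A \<Longrightarrow> times_bcontfun f g \<in> A"
  and separates: "s \<noteq> t \<Longrightarrow> \<exists>f\<in>A. apply_bcontfun f s \<noteq> apply_bcontfun f t"
  using uniform_algebra unfolding uniform_algebra_def by auto

lemma scaleR_in:
  assumes "f \<in> A" shows "r *\<^sub>R f \<in> A"
proof -
  have "r *\<^sub>R f = times_bcontfun (const_bcontfun (of_real r)) f"
    by (rule bcontfun_eqI) (simp add: scaleR_conv_of_real)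
  then show ?thesis using times_in[OF const_in assms] by simp
qed

lemma diff_in:
  assumes "f \<in> A" "g \<in> A" shows "f - g \<in> A"
  using add_in[OF assms(1) scaleR_in[OF assms(2), of "-1"]] by simp

lemma sum_in: "(\<And>i. i \<in> I \<Longrightarrow> f i \<in> A) \<Longrightarrow> (\<Sum>i\<in>I. f i) \<in> A"
proof (induction I rule: infinite_finite_induct)
  case (insert x F)
  then show ?case by (simp add: add_in)
qed (use const_in[of 0] in simp_all)

lemma power_ex:
  assumes "f \<in> A"
  shows "\<exists>g\<in>A. \<forall>t. apply_bcontfun g t = apply_bcontfun f t ^ n"
proof (induction n)
  case 0
  then show ?case using const_in[of 1] by (intro bexI[of _ "const_bcontfun 1"]) auto
next
  case (Suc n)
  then obtain g where "g \<in> A" "\<forall>t. apply_bcontfun g t = apply_bcontfun f t ^ n" by blast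
  then show ?case using times_in[OF assms, of g]
    by (intro bexI[of _ "times_bcontfun f g"]) auto
qed

lemma boundary_for_UNIV: "boundary_for A UNIV"
  unfolding boundary_for_def
proof
  fix \<phi> assume "\<phi> \<in> A"
  have "\<exists>t\<in>UNIV. \<forall>s\<in>UNIV. norm (apply_bcontfun \<phi> s) \<le> norm (apply_bcontfun \<phi> t)"
    by (intro continuous_attains_sup compact_UNIV continuous_intros) auto
  then obtain t where "\<And>s. norm (apply_bcontfun \<phi> s) \<le> norm (apply_bcontfun \<phi> t)" by auto
  then have "norm (apply_bcontfun \<phi> t) = norm \<phi>"
    by (intro antisym norm_bounded norm_bound)
  then show "\<exists>t\<in>UNIV. norm (apply_bcontfun \<phi> t) = norm \<phi>" by blast
qed

lemma closed_imp_compact: "closed S \<Longrightarrow> compact (S :: 'a set)"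
  using compact_Int_closed[OF compact_UNIV] by simp

lemma norm_le_of_boundary:
  assumes "boundary_for A S" "\<phi> \<in> A" "\<And>t. t \<in> S \<Longrightarrow> norm (apply_bcontfun \<phi> t) \<le> b"
  shows "norm \<phi> \<le> b"
  using assms unfolding boundary_for_def by metis

section \<open>Basic neighbourhoods and Bear's argument\<close>

definition basic_nhd :: "('a \<Rightarrow>\<^sub>C complex) set \<Rightarrow> 'a set" where
  "basic_nhd F = {t. \<forall>g\<in>F. norm (apply_bcontfun g t) < 1}"

lemma open_basic_nhd: "finite F \<Longrightarrow> open (basic_nhd F)"
proof -
  assume "finite F"
  have "basic_nhd F = (\<Inter>g\<in>F. {t. norm (apply_bcontfun g t) < 1})"
    by (auto simp: basic_nhd_def)
  also have "open \<dots>"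
    by (intro open_INT ballI open_Collect_less continuous_intros \<open>finite F\<close>) auto
  finally show ?thesis .
qed

text \<open>By compactness the functions in \<open>A\<close> already induce the topology: each point
  outside \<open>U\<close> has a neighbourhood where some function of \<open>A\<close> vanishing at
  \<open>x\<close> exceeds 1 in modulus, and finitely many of these cover the complement.\<close>

lemma basic_nhd_exists:
  assumes "open U" "x \<in> U"
  obtains F where "finite F" "F \<subseteq> A" "x \<in> basic_nhd F" "basic_nhd F \<subseteq> U"
proof -
  have "\<exists>g\<in>A. apply_bcontfun g x = 0 \<and> norm (apply_bcontfun g y) > 1" if "y \<in> - U" for y
  proof -
    have "x \<noteq> y" using that assms(2) by auto
    then obtain f where f: "f \<in> A" "apply_bcontfun f x \<noteq> apply_bcontfun f y"
      using separates by blast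
    define c where "c = apply_bcontfun f y - apply_bcontfun f x"
    define g where "g = times_bcontfun (const_bcontfun (2 / c)) (f - const_bcontfun (apply_bcontfun f x))"
    have "g \<in> A"
      unfolding g_def by (intro times_in diff_in const_in f)
    moreover have "apply_bcontfun g x = 0" "apply_bcontfun g y = 2"
      using f(2) by (auto simp: g_def c_def divide_simps)
    ultimately show ?thesis by force
  qed
  then obtain g where g: "\<And>y. y \<in> - U \<Longrightarrow> g y \<in> A"
    "\<And>y. y \<in> - U \<Longrightarrow> apply_bcontfun (g y) x = 0"
    "\<And>y. y \<in> - U \<Longrightarrow> norm (apply_bcontfun (g y) y) > 1"
    by metis
  have "compact (- U)"
    using assms(1) by (intro closed_imp_compact) auto
  moreover have "open {t. 1 < norm (apply_bcontfun (g y) t)}" for y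
    by (intro open_Collect_less continuous_intros) auto
  moreover have "- U \<subseteq> (\<Union>y\<in>-U. {t. 1 < norm (apply_bcontfun (g y) t)})"
    using g(3) by auto
  ultimately obtain Y where Y: "Y \<subseteq> - U" "finite Y"
    "- U \<subseteq> (\<Union>y\<in>Y. {t. 1 < norm (apply_bcontfun (g y) t)})"
    by (rule compactE_image)
  show thesis
  proof
    show "finite (g ` Y)" using Y by simp
    show "g ` Y \<subseteq> A" using Y g(1) by auto
    show "x \<in> basic_nhd (g ` Y)" using Y(1) g(2) by (auto simp: basic_nhd_def subset_iff)
    show "basic_nhd (g ` Y) \<subseteq> U"
    proof
      fix t assume t: "t \<in> basic_nhd (g ` Y)"
      then have "t \<notin> (\<Union>y\<in>Y. {t. 1 < norm (apply_bcontfun (g y) t)})"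
        by (force simp: basic_nhd_def)
      then show "t \<in> U" using Y(3) by blast
    qed
  qed
qed

lemma compact_norm_bound_less_one:
  fixes \<phi> :: "'a \<Rightarrow>\<^sub>C complex"
  assumes "compact S" "\<And>t. t \<in> S \<Longrightarrow> norm (apply_bcontfun \<phi> t) < 1"
  obtains c where "0 \<le> c" "c < 1" "\<And>t. t \<in> S \<Longrightarrow> norm (apply_bcontfun \<phi> t) \<le> c"
proof (cases "S = {}")
  case True
  then show ?thesis using that[of 0] by simp
next
  case False
  have "\<exists>t\<in>S. \<forall>s\<in>S. norm (apply_bcontfun \<phi> s) \<le> norm (apply_bcontfun \<phi> t)"
    by (intro continuous_attains_sup assms False continuous_intros) auto
  then show ?thesis using that assms(2) norm_ge_zero by metis
qed

text \<open>A function that misses its norm on \<open>S\<close> is divided by its value at a norming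
  point in \<open>E\<close>.\<close>

lemma not_boundaryE:
  assumes E: "boundary_for A E" and "\<not> boundary_for A S"
  obtains p t where "p \<in> A" "norm p = 1" "t \<in> E" "apply_bcontfun p t = 1"
    "\<And>s. s \<in> S \<Longrightarrow> norm (apply_bcontfun p s) < 1"
proof -
  obtain \<phi> where \<phi>: "\<phi> \<in> A" "\<And>s. s \<in> S \<Longrightarrow> norm (apply_bcontfun \<phi> s) \<noteq> norm \<phi>"
    using assms(2) unfolding boundary_for_def by blast
  obtain t where t: "t \<in> E" "norm (apply_bcontfun \<phi> t) = norm \<phi>"
    using E \<phi>(1) unfolding boundary_for_def by blast
  show thesis
  proof (cases "\<phi> = 0")
    \<comment> \<open>The zero function attains its norm at every point, so \<open>S\<close> is
      empty and the constant 1 serves.\<close>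
    case True
    then have "S = {}" using \<phi>(2) by auto
    moreover have "norm (const_bcontfun 1 :: 'a \<Rightarrow>\<^sub>C complex) = 1"
      using norm_bounded[of "const_bcontfun 1 :: 'a \<Rightarrow>\<^sub>C complex" t]
      by (intro antisym norm_bound) auto
    ultimately show thesis
      using that[of "const_bcontfun 1" t] t(1) const_in by auto
  next
    case False
    then have pos: "norm \<phi> > 0" by simp
    define p where "p = times_bcontfun (const_bcontfun (1 / apply_bcontfun \<phi> t)) \<phi>"
    have p: "norm (apply_bcontfun p s) = norm (apply_bcontfun \<phi> s) / norm \<phi>" for s
      by (simp add: p_def norm_mult norm_divide t(2))
    have pt: "apply_bcontfun p t = 1"
      using pos t(2) by (auto simp: p_def)
    show thesis
    proof (rule that[of p t])
      show "p \<in> A" unfolding p_def by (intro times_in const_in \<phi>)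
      show "norm p = 1"
      proof (rule antisym)
        show "norm p \<le> 1"
          by (rule norm_bound) (use pos norm_bounded in \<open>simp add: p\<close>)
        show "1 \<le> norm p" using norm_bounded[of p t] pt by simp
      qed
      show "norm (apply_bcontfun p s) < 1" if "s \<in> S" for s
        using \<phi>(2)[OF that] norm_bounded[of \<phi> s] pos by (simp add: p)
    qed (use pt t in auto)
  qed
qed

text \<open>Otherwise some \<open>p\<close> of norm 1 stays below 1 in modulus on the remaining set.
  For a high power \<open>q\<close> of \<open>p\<close>, each product of \<open>q\<close> with a
  member of \<open>F\<close> has norm below 1: inside the neighbourhood by the bound on the member,
  outside by the smallness of \<open>q\<close>. At a point of \<open>S\<close> with |p| = 1 all
  members are then below 1, so this point lies in the neighbourhood.\<close>

lemma boundary_Diff_basic_nhd: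
  assumes F: "finite F" "F \<subseteq> A"
    and S: "boundary_for A S" "basic_nhd F \<inter> S = {}"
    and E: "closed E" "boundary_for A E"
  shows "boundary_for A (E - basic_nhd F)"
proof (rule ccontr)
  assume "\<not> ?thesis"
  then obtain p where p: "p \<in> A" "norm p = 1"
    "\<And>s. s \<in> E - basic_nhd F \<Longrightarrow> norm (apply_bcontfun p s) < 1"
    using not_boundaryE[OF S(1)] by metis
  have "compact (E - basic_nhd F)"
    using E(1) open_basic_nhd[OF F(1)] by (intro closed_imp_compact closed_Diff)
  then obtain c where c: "0 \<le> c" "c < 1"
    "\<And>s. s \<in> E - basic_nhd F \<Longrightarrow> norm (apply_bcontfun p s) \<le> c"
    using compact_norm_bound_less_one p(3) by metis
  \<comment> \<open>\<open>C\<close> bounds all members of \<open>F\<close>, so c^n C < 1 controls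
    every product at once; the summand 1 keeps \<open>C\<close> positive for empty
    \<open>F\<close>.\<close>
  define C where "C = (\<Sum>g\<in>F. norm g) + 1"
  have C: "norm g < C" if "g \<in> F" for g
    using member_le_sum[of g F norm] that F(1) by (simp add: C_def)
  have "0 < C" by (simp add: C_def add_nonneg_pos sum_nonneg)
  then obtain n where n: "c ^ n < 1 / C"
    using real_arch_pow_inv[of "1 / C" c] c by auto
  obtain q where q: "q \<in> A" "\<And>t. apply_bcontfun q t = apply_bcontfun p t ^ n"
    using power_ex[OF p(1)] by metis
  obtain t where t: "t \<in> S" "norm (apply_bcontfun p t) = 1"
    using S(1) p(1,2) unfolding boundary_for_def by metis
  have "norm (apply_bcontfun g t) < 1" if g: "g \<in> F" for g
  proof -
    obtain s where s: "s \<in> E"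
      "norm (apply_bcontfun (times_bcontfun q g) s) = norm (times_bcontfun q g)"
      using E(2) times_in[OF q(1), of g] F(2) g unfolding boundary_for_def by blast
    have "norm (apply_bcontfun g t) = norm (apply_bcontfun (times_bcontfun q g) t)"
      by (simp add: q(2) norm_mult norm_power t(2))
    also have "\<dots> \<le> norm (apply_bcontfun p s) ^ n * norm (apply_bcontfun g s)"
      using norm_bounded[of "times_bcontfun q g" t] s(2)
      by (simp add: q(2) norm_mult norm_power)
    also have "\<dots> < 1"
    proof (cases "s \<in> basic_nhd F")
      case True
      have "norm (apply_bcontfun p s) ^ n \<le> 1"
        using norm_bounded[of p s] p(2) by (simp add: power_le_one)
      then have "norm (apply_bcontfun p s) ^ n * norm (apply_bcontfun g s)
          \<le> norm (apply_bcontfun g s)"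
        by (intro mult_left_le_one_le) auto
      then show ?thesis using True g by (auto simp: basic_nhd_def)
    next
      case False
      have "norm (apply_bcontfun p s) ^ n * norm (apply_bcontfun g s) \<le> c ^ n * C"
        using False s(1) c C[OF g] norm_bounded[of g s]
        by (intro mult_mono power_mono) auto
      also have "\<dots> < 1" using n \<open>0 < C\<close> by (simp add: field_simps)
      finally show ?thesis .
    qed
    finally show ?thesis .
  qed
  then have "t \<in> basic_nhd F" by (simp add: basic_nhd_def)
  then show False using t(1) S(2) by blast
qed

text \<open>If \<open>p\<close> missed its norm on the intersection, its norming set
  \<open>M\<close> would be compact and covered by finitely many removable neighbourhoods. Removing
  them one by one from the whole space leaves a closed boundary on which \<open>p\<close> still
  misses its norm.\<close>

lemma boundary_Inter:
  "boundary_for A (\<Inter>{S. closed S \<and> boundary_for A S})" (is "boundary_for A ?\<Gamma>")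
proof (rule ccontr)
  assume "\<not> ?thesis"
  then obtain p where p: "p \<in> A" "norm p = 1"
    "\<And>s. s \<in> ?\<Gamma> \<Longrightarrow> norm (apply_bcontfun p s) < 1"
    using not_boundaryE[OF boundary_for_UNIV] by metis
  define M where "M = {s. norm (apply_bcontfun p s) = 1}"
  have "closed M"
    unfolding M_def by (intro closed_Collect_eq continuous_intros) auto
  have "\<exists>F S. finite F \<and> F \<subseteq> A \<and> x \<in> basic_nhd F \<and> boundary_for A S \<and> basic_nhd F \<inter> S = {}"
    if "x \<in> M" for x
  proof -
    have "x \<notin> ?\<Gamma>" using p(3)[of x] that by (auto simp: M_def)
    then obtain S where S: "closed S" "boundary_for A S" "x \<in> - S" by blast
    obtain F where "finite F" "F \<subseteq> A" "x \<in> basic_nhd F" "basic_nhd F \<subseteq> - S"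
      using basic_nhd_exists[of "- S" x] S by auto
    then show ?thesis using S(2) by blast
  qed
  then obtain F where F: "\<And>x. x \<in> M \<Longrightarrow> finite (F x)" "\<And>x. x \<in> M \<Longrightarrow> F x \<subseteq> A"
    "\<And>x. x \<in> M \<Longrightarrow> x \<in> basic_nhd (F x)"
    "\<And>x. x \<in> M \<Longrightarrow> \<exists>S. boundary_for A S \<and> basic_nhd (F x) \<inter> S = {}"
    by metis
  obtain X where X: "X \<subseteq> M" "finite X" "M \<subseteq> (\<Union>x\<in>X. basic_nhd (F x))"
    by (rule compactE_image[OF closed_imp_compact[OF \<open>closed M\<close>], of M "\<lambda>x. basic_nhd (F x)"])
      (use F open_basic_nhd in auto)
  have "closed (UNIV - (\<Union>x\<in>X. basic_nhd (F x))) \<and> boundary_for A (UNIV - (\<Union>x\<in>X. basic_nhd (F x)))"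
    using X(2,1)
  proof (induction X rule: finite_induct)
    case empty
    then show ?case by (simp add: boundary_for_UNIV)
  next
    case (insert x X)
    then obtain S where S: "boundary_for A S" "basic_nhd (F x) \<inter> S = {}"
      using F(4)[of x] by blast
    have eq: "UNIV - (\<Union>x\<in>insert x X. basic_nhd (F x))
        = (UNIV - (\<Union>x\<in>X. basic_nhd (F x))) - basic_nhd (F x)"
      by auto
    show ?case
      unfolding eq using insert F(1,2)[of x]
      by (blast intro: boundary_Diff_basic_nhd[OF _ _ S] closed_Diff open_basic_nhd)
  qed
  then obtain s where "s \<notin> (\<Union>x\<in>X. basic_nhd (F x))" "norm (apply_bcontfun p s) = 1"
    using p(1,2) unfolding boundary_for_def by fastforce
  then show False using X(3) by (auto simp: M_def)
qed

lemma shilov_boundary_eq: "shilov_boundary A = \<Inter>{S. closed S \<and> boundary_for A S}"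
  unfolding shilov_boundary_def
  by (rule Least_equality) (use boundary_Inter in \<open>auto intro!: closed_Inter\<close>)

lemma closed_shilov: "closed (shilov_boundary A)"
  unfolding shilov_boundary_eq by (auto intro!: closed_Inter)

lemma boundary_shilov: "boundary_for A (shilov_boundary A)"
  unfolding shilov_boundary_eq by (rule boundary_Inter)

lemma shilov_subset: "closed S \<Longrightarrow> boundary_for A S \<Longrightarrow> shilov_boundary A \<subseteq> S"
  unfolding shilov_boundary_eq by auto

section \<open>Peaking functions with values near the unit segment\<close>

text \<open>By minimality the Shilov boundary without \<open>U\<close> is no boundary, which yields
  \<open>p\<close> peaking inside \<open>U\<close>; averaging lacunary powers of (1 + p) / 2
  flattens its range.\<close>

lemma shilov_peak:
  assumes U: "open U" "shilov_boundary A \<inter> U \<noteq> {}" and \<delta>: "0 < \<delta>"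
  obtains h t where "h \<in> A" "t \<in> shilov_boundary A \<inter> U" "apply_bcontfun h t = 1"
    "\<And>s. s \<in> shilov_boundary A - U \<Longrightarrow> norm (apply_bcontfun h s) \<le> \<delta>"
    "\<And>s. norm (apply_bcontfun h s) + norm (1 - apply_bcontfun h s) \<le> 1 + \<delta>"
proof -
  let ?\<Gamma> = "shilov_boundary A"
  have cl: "closed (?\<Gamma> - U)" using closed_shilov U(1) by (intro closed_Diff)
  have "\<not> boundary_for A (?\<Gamma> - U)"
    using shilov_subset[OF cl] U(2) by blast
  then obtain p t where p: "p \<in> A" "norm p = 1" "t \<in> ?\<Gamma>" "apply_bcontfun p t = 1"
    "\<And>s. s \<in> ?\<Gamma> - U \<Longrightarrow> norm (apply_bcontfun p s) < 1"
    using not_boundaryE[OF boundary_shilov] by metis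
  obtain c where c: "0 \<le> c" "c < 1" "\<And>s. s \<in> ?\<Gamma> - U \<Longrightarrow> norm (apply_bcontfun p s) \<le> c"
    using compact_norm_bound_less_one[OF closed_imp_compact[OF cl]] p(5) by metis
  define w where "w = (1/2) *\<^sub>R (const_bcontfun 1 + p)"
  have wA: "w \<in> A" unfolding w_def by (intro scaleR_in add_in const_in p)
  have w: "apply_bcontfun w s = (1 + apply_bcontfun p s) / 2" for s
    by (simp add: w_def scaleR_conv_of_real)
  \<comment> \<open>Parallelogram law: |1 + p|^2 + |1 - p|^2 = 2 + 2 |p|^2 \<le> 4.\<close>
  have wdisc: "(norm (apply_bcontfun w s))\<^sup>2 + (norm (1 - apply_bcontfun w s))\<^sup>2 \<le> 1" for s
  proof -
    have "(norm (apply_bcontfun p s))\<^sup>2 \<le> 1\<^sup>2"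
      using norm_bounded[of p s] p(2) by (intro power_mono) auto
    moreover have "1 - apply_bcontfun w s = (1 - apply_bcontfun p s) / 2"
      by (simp add: w field_simps)
    ultimately show ?thesis
      unfolding w norm_divide power_divide cmod_power2
      by (simp add: field_simps power2_eq_square)
  qed
  have wc: "norm (apply_bcontfun w s) \<le> (1 + c) / 2" if "s \<in> ?\<Gamma> - U" for s
    using norm_triangle_ineq[of 1 "apply_bcontfun p s"] c(3)[OF that] by (simp add: w norm_divide)
  \<comment> \<open>Exponents of at least \<open>M\<close> make every power, hence the average, at
    most \<delta> off \<open>U\<close>.\<close>
  obtain M where M: "((1 + c) / 2) ^ M < \<delta>"
    using real_arch_pow_inv[of \<delta> "(1 + c) / 2"] \<delta> c by auto
  have "0 < \<delta>/4"
    using \<delta> by simp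
  obtain m :: "nat \<Rightarrow> nat" where m: "\<And>k. M \<le> m k"
    "\<And>k l. k < l \<Longrightarrow> (real (m k))\<^sup>2 \<le> (\<delta>/4) ^ 4 * real (m l)"
    using lacunary_sequence_exists[OF \<open>0 < \<delta>/4\<close>, of M] by metis
  have "\<forall>k. \<exists>g. g \<in> A \<and> (\<forall>s. apply_bcontfun g s = apply_bcontfun w s ^ m k)"
    using power_ex[OF wA] by blast
  then obtain v where v: "\<And>k. v k \<in> A" "\<And>k s. apply_bcontfun (v k) s = apply_bcontfun w s ^ m k"
    by metis
  \<comment> \<open>The excess over 1 is 2 (\<delta>/4) from the good powers plus 2/N from the
    exceptional one, at most \<delta> in total.\<close>
  obtain N :: nat where N: "4 / \<delta> < real N" using reals_Archimedean2 by blast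
  have "0 < 4 / \<delta>" using \<delta> by simp
  then have N0: "0 < real N" using N by linarith
  have N2: "2 / real N \<le> \<delta> / 2" using N \<delta> N0 by (simp add: field_simps)
  define h where "h = (1 / real N) *\<^sub>R (\<Sum>k<N. v k)"
  have h: "apply_bcontfun h s = (\<Sum>k<N. apply_bcontfun w s ^ m k) /\<^sub>R real N" for s
    by (simp add: h_def apply_bcontfun_sum v(2) divide_inverse_commute)
  have h1: "1 - apply_bcontfun h s = (\<Sum>k<N. 1 - apply_bcontfun w s ^ m k) /\<^sub>R real N" for s
    using N0 by (simp add: h sum_subtractf scaleR_conv_of_real field_simps)
  show thesis
  proof (rule that[of h t])
    show "h \<in> A" unfolding h_def by (intro scaleR_in sum_in v)
    show "t \<in> ?\<Gamma> \<inter> U" using p(3-5) by force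
    show "apply_bcontfun h t = 1" using N0 by (simp add: h w p(4) scaleR_conv_of_real)
    show "norm (apply_bcontfun h s) \<le> \<delta>" if s: "s \<in> ?\<Gamma> - U" for s
    proof -
      have "norm (apply_bcontfun w s ^ m k) \<le> \<delta>" for k
      proof -
        have "norm (apply_bcontfun w s ^ m k) \<le> ((1 + c) / 2) ^ m k"
          using wc[OF s] by (simp add: norm_power power_mono)
        also have "\<dots> \<le> ((1 + c) / 2) ^ M"
          using c m(1) by (intro power_decreasing) auto
        finally show ?thesis using M by simp
      qed
      then have "norm (\<Sum>k<N. apply_bcontfun w s ^ m k) \<le> real N * \<delta>"
        using sum_norm_bound[of "{..<N}" "\<lambda>k. apply_bcontfun w s ^ m k" \<delta>] by simp
      then show ?thesis using N0 by (simp add: h field_simps)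
    qed
    show "norm (apply_bcontfun h s) + norm (1 - apply_bcontfun h s) \<le> 1 + \<delta>" for s
    proof -
      have "norm (apply_bcontfun h s) + norm (1 - apply_bcontfun h s)
          \<le> (\<Sum>k<N. norm (apply_bcontfun w s ^ m k)) / real N
            + (\<Sum>k<N. norm (1 - apply_bcontfun w s ^ m k)) / real N"
        unfolding h1 unfolding h norm_scaleR using N0
        by (intro add_mono) (simp_all add: divide_inverse_commute norm_sum)
      also have "\<dots> = (\<Sum>k<N. norm (apply_bcontfun w s ^ m k)
          + norm (1 - apply_bcontfun w s ^ m k)) / real N"
        by (simp add: sum.distrib add_divide_distrib)
      also have "\<dots> \<le> (real N * (1 + 2 * (\<delta>/4)) + 2) / real N"
        using \<delta> N0 by (intro divide_right_mono lacunary_powers_near_segment wdisc m) auto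
      also have "\<dots> = 1 + \<delta> / 2 + 2 / real N"
        using N0 by (simp add: field_simps)
      finally show ?thesis using N2 by simp
    qed
  qed
qed

section \<open>Daugavet points and Delta-points\<close>

lemma unit_ball_eq: "{y \<in> A. norm y \<le> 1} = A \<inter> cball 0 1"
  by auto

lemma convex_A: "convex A"
  unfolding convex_def by (auto intro: add_in scaleR_in)

lemma Daugavet_point_of_limit_point:
  assumes f: "f \<in> A" "norm f = 1"
    and t\<^sub>0: "t\<^sub>0 islimpt shilov_boundary A" "norm (apply_bcontfun f t\<^sub>0) = 1"
  shows "Daugavet_point A f"
proof -
  let ?\<Gamma> = "shilov_boundary A"
  define c where "c = apply_bcontfun f t\<^sub>0"
  have c: "norm c = 1" using t\<^sub>0 by (simp add: c_def)
  have approx: "\<exists>y\<in>convex hull Delta_set A \<epsilon> f. dist y g \<le> \<tau>"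
    if g: "g \<in> A" "norm g \<le> 1" and \<epsilon>: "0 < \<epsilon>" and \<tau>: "0 < \<tau>" for g \<epsilon> \<tau>
  proof -
    \<comment> \<open>The three bounds serve |h| \<le> 2, the distance 2 - 2\<delta> \<ge> 2 -
      \<epsilon>, and the final error 4/N + 3\<delta> \<le> \<tau>.\<close>
    define \<delta> where "\<delta> = min 1 (min (\<epsilon>/2) (\<tau>/6))"
    have \<delta>: "0 < \<delta>" "\<delta> \<le> 1" "2 * \<delta> \<le> \<epsilon>" "6 * \<delta> \<le> \<tau>"
      using \<epsilon> \<tau> by (auto simp: \<delta>_def min_def)
    obtain N :: nat where N: "8 / \<tau> < real N" using reals_Archimedean2 by blast
    have "0 < 8 / \<tau>" using \<tau> by simp
    then have N0: "0 < real N" using N by linarith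
    have N2: "4 / real N \<le> \<tau> / 2" using N \<tau> N0 by (simp add: field_simps)
    define V where "V = {t. norm (apply_bcontfun f t - c) < \<delta>}"
    have "open V" unfolding V_def by (intro open_Collect_less continuous_intros) auto
    moreover have "t\<^sub>0 \<in> V" using \<delta> by (simp add: V_def c_def)
    ultimately obtain U where U: "disjoint_family_on U {..<N}"
      "\<And>i. i < N \<Longrightarrow> open (U i) \<and> U i \<subseteq> V \<and> ?\<Gamma> \<inter> U i \<noteq> {}"
      using islimpt_disjoint_open_family[OF t\<^sub>0(1)] by metis
    have "\<exists>h t. h \<in> A \<and> t \<in> U i \<and> apply_bcontfun h t = 1
        \<and> (\<forall>s\<in>?\<Gamma> - U i. norm (apply_bcontfun h s) \<le> \<delta>)
        \<and> (\<forall>s. norm (apply_bcontfun h s) + norm (1 - apply_bcontfun h s) \<le> 1 + \<delta>)"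
      if i: "i < N" for i
      using shilov_peak[of "U i" \<delta>] U(2)[OF i] \<delta>(1) by (smt (verit) Int_iff)
    then obtain h t where h: "\<And>i. i < N \<Longrightarrow> h i \<in> A" "\<And>i. i < N \<Longrightarrow> t i \<in> U i"
      "\<And>i. i < N \<Longrightarrow> apply_bcontfun (h i) (t i) = 1"
      "\<And>i s. i < N \<Longrightarrow> s \<in> ?\<Gamma> - U i \<Longrightarrow> norm (apply_bcontfun (h i) s) \<le> \<delta>"
      "\<And>i s. i < N \<Longrightarrow> norm (apply_bcontfun (h i) s) + norm (1 - apply_bcontfun (h i) s) \<le> 1 + \<delta>"
      by metis
    \<comment> \<open>This is (1 - h) g - c h, written so that g - z = h (g + c) is visible.\<close>
    define z where "z i = g - times_bcontfun (h i) (g + const_bcontfun c)" for i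
    have zA: "z i \<in> A" if "i < N" for i
      unfolding z_def by (intro diff_in times_in add_in const_in g h that)
    have z: "apply_bcontfun (z i) s
        = (1 - apply_bcontfun (h i) s) * apply_bcontfun g s - apply_bcontfun (h i) s * c" for i s
      by (simp add: z_def algebra_simps)
    have g1: "norm (apply_bcontfun g s) \<le> 1" for s
      using norm_bounded[of g s] g(2) by simp
    have znorm: "norm (z i) \<le> 1 + \<delta>" if "i < N" for i
    proof (rule norm_bound)
      fix s
      have "norm (apply_bcontfun (z i) s)
          \<le> norm (1 - apply_bcontfun (h i) s) * norm (apply_bcontfun g s)
            + norm (apply_bcontfun (h i) s)"
        unfolding z using norm_triangle_ineq4[of "(1 - apply_bcontfun (h i) s) * apply_bcontfun g s"
            "apply_bcontfun (h i) s * c"] by (simp add: norm_mult c)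
      also have "\<dots> \<le> norm (1 - apply_bcontfun (h i) s) + norm (apply_bcontfun (h i) s)"
        using g1 by (simp add: mult_left_le)
      finally show "norm (apply_bcontfun (z i) s) \<le> 1 + \<delta>" using h(5)[OF that, of s] by simp
    qed
    define y where "y i = (1 / (1 + \<delta>)) *\<^sub>R z i" for i
    have yD: "y i \<in> Delta_set A \<epsilon> f" if i: "i < N" for i
    proof -
      have "norm (y i) \<le> 1"
        using znorm[OF i] \<delta>(1) by (simp add: y_def field_simps)
      \<comment> \<open>At \<open>t i\<close> the function \<open>f\<close> is within \<delta> of
        \<open>c\<close> while \<open>y i\<close> equals -c / (1 + \<delta>), so the distance is at
        least 1 + 1 / (1 + \<delta>) - \<delta> \<ge> 2 - 2\<delta>.\<close>
      moreover have "2 - \<epsilon> \<le> norm (f - y i)"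
      proof -
        have "apply_bcontfun (y i) (t i) = - ((1 / (1 + \<delta>)) *\<^sub>R c)"
          using h(3)[OF i] by (simp add: y_def z)
        then have eq: "c + (1 / (1 + \<delta>)) *\<^sub>R c
            = apply_bcontfun (f - y i) (t i) - (apply_bcontfun f (t i) - c)"
          by simp
        have "norm (c + (1 / (1 + \<delta>)) *\<^sub>R c) = 1 + 1 / (1 + \<delta>)"
        proof -
          have "c + (1 / (1 + \<delta>)) *\<^sub>R c = (1 + 1 / (1 + \<delta>)) *\<^sub>R c"
            by (simp only: scaleR_left_distrib scaleR_one)
          then show ?thesis using c \<delta>(1) by simp
        qed
        moreover have "norm (c + (1 / (1 + \<delta>)) *\<^sub>R c)
            \<le> norm (apply_bcontfun (f - y i) (t i)) + norm (apply_bcontfun f (t i) - c)"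
          unfolding eq by (rule norm_triangle_ineq4)
        moreover have "norm (apply_bcontfun f (t i) - c) < \<delta>"
          using h(2)[OF i] U(2)[OF i] by (auto simp: V_def)
        moreover have "1 - \<delta> \<le> 1 / (1 + \<delta>)"
          using \<delta>(1) by (simp add: field_simps)
        ultimately show ?thesis
          using norm_bounded[of "f - y i" "t i"] \<delta>(3) by linarith
      qed
      ultimately show ?thesis
        using scaleR_in[OF zA[OF i]] by (simp add: Delta_set_def y_def)
    qed
    define Y where "Y = (\<Sum>i<N. (1 / real N) *\<^sub>R y i)"
    have Y: "Y \<in> convex hull Delta_set A \<epsilon> f"
      unfolding Y_def using N0 yD
      by (intro convex_sum convex_convex_hull) (auto intro: hull_inc)
    have YA: "Y \<in> A" unfolding Y_def y_def by (intro sum_in scaleR_in zA) auto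
    have Y1: "norm Y \<le> 1"
    proof -
      have "norm Y \<le> (\<Sum>i<N. norm ((1 / real N) *\<^sub>R y i))" unfolding Y_def by (rule norm_sum)
      also have "\<dots> \<le> (\<Sum>i<N. 1 / real N)"
        using yD by (intro sum_mono) (auto simp: Delta_set_def divide_right_mono)
      finally show ?thesis using N0 by simp
    qed
    \<comment> \<open>Rescaling \<open>Y\<close> gives back the plain average of the
      \<open>z i\<close>. Testing on the Shilov boundary is enough, and only there are the
      \<open>h i\<close> known to be small off \<open>U i\<close>.\<close>
    have "norm ((1 + \<delta>) *\<^sub>R Y - g) \<le> 4 / real N + 2 * \<delta>"
    proof (rule norm_le_of_boundary[OF boundary_shilov])
      show "(1 + \<delta>) *\<^sub>R Y - g \<in> A" by (intro diff_in scaleR_in YA g)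
      fix s assume s: "s \<in> ?\<Gamma>"
      have Yz: "(1 + \<delta>) *\<^sub>R Y = (\<Sum>i<N. (1 / real N) *\<^sub>R z i)"
        using \<delta>(1) by (simp add: Y_def y_def scaleR_sum_right)
      have "apply_bcontfun ((1 + \<delta>) *\<^sub>R Y - g) s
          = (\<Sum>i<N. (1 / real N) *\<^sub>R apply_bcontfun (z i) s) - apply_bcontfun g s"
        unfolding Yz by (simp add: apply_bcontfun_sum)
      also have "\<dots> = (\<Sum>i<N. (1 / real N) *\<^sub>R (apply_bcontfun (z i) s - apply_bcontfun g s))"
        using N0 by (simp add: scaleR_diff_right sum_subtractf) (simp add: scaleR_conv_of_real)
      also have "\<dots> = (\<Sum>i<N. (1 / real N) *\<^sub>R
          (- (apply_bcontfun (h i) s * (apply_bcontfun g s + c))))"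
        by (simp add: z_def)
      also have "norm \<dots> \<le> (\<Sum>i<N. 2 / real N * norm (apply_bcontfun (h i) s))"
      proof (rule order_trans[OF norm_sum sum_mono])
        fix i
        have "norm (apply_bcontfun g s + c) \<le> 2"
          using norm_triangle_ineq[of "apply_bcontfun g s" c] g1[of s] c by simp
        then show "norm ((1 / real N) *\<^sub>R (- (apply_bcontfun (h i) s * (apply_bcontfun g s + c))))
            \<le> 2 / real N * norm (apply_bcontfun (h i) s)"
          using mult_left_mono[of "norm (apply_bcontfun g s + c)" 2 "norm (apply_bcontfun (h i) s)"]
          by (simp add: norm_mult divide_right_mono mult.commute)
      qed
      also have "\<dots> = 2 / real N * (\<Sum>i<N. norm (apply_bcontfun (h i) s))"
        by (simp add: sum_distrib_left)
      also have "\<dots> \<le> 2 / real N * (2 + real N * \<delta>)"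
      proof (intro mult_left_mono sum_le_of_disjoint_family[OF U(1), where s = s])
        show "norm (apply_bcontfun (h i) s) \<le> 2" if "i < N" for i
          using h(5)[OF that, of s] \<delta>(2) norm_ge_zero[of "1 - apply_bcontfun (h i) s"]
          by linarith
        show "norm (apply_bcontfun (h i) s) \<le> \<delta>" if "i < N" "s \<notin> U i" for i
          using h(4)[OF that(1), of s] that(2) s by simp
      qed (use \<delta> in auto)
      also have "\<dots> = 4 / real N + 2 * \<delta>"
        using N0 by (simp add: field_simps)
      finally show "norm (apply_bcontfun ((1 + \<delta>) *\<^sub>R Y - g) s) \<le> 4 / real N + 2 * \<delta>" .
    qed
    moreover have "norm (\<delta> *\<^sub>R Y) \<le> \<delta>" using Y1 \<delta>(1) by (simp add: mult_left_le)
    moreover have "norm (Y - g) \<le> norm ((1 + \<delta>) *\<^sub>R Y - g) + norm (\<delta> *\<^sub>R Y)"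
    proof -
      have "(1 + \<delta>) *\<^sub>R Y - g - \<delta> *\<^sub>R Y = Y - g"
        by (simp add: scaleR_left_distrib)
      then show ?thesis
        using norm_triangle_ineq4[of "(1 + \<delta>) *\<^sub>R Y - g" "\<delta> *\<^sub>R Y"] by metis
    qed
    ultimately have "norm (Y - g) \<le> 4 / real N + 3 * \<delta>"
      by linarith
    then have "dist Y g \<le> \<tau>" using N2 \<delta>(4) by (simp add: dist_norm)
    then show ?thesis using Y by blast
  qed
  have "{y \<in> A. norm y \<le> 1} = closure (convex hull Delta_set A \<epsilon> f)" if "0 < \<epsilon>" for \<epsilon>
  proof (rule antisym)
    show "{y \<in> A. norm y \<le> 1} \<subseteq> closure (convex hull Delta_set A \<epsilon> f)"
      using approx[OF _ _ that] by (auto simp: closure_approachable_le)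
    have "convex hull Delta_set A \<epsilon> f \<subseteq> A \<inter> cball 0 1"
      by (intro hull_minimal convex_Int convex_A convex_cball) (auto simp: Delta_set_def)
    then show "closure (convex hull Delta_set A \<epsilon> f) \<subseteq> {y \<in> A. norm y \<le> 1}"
      unfolding unit_ball_eq by (intro closure_minimal closed_Int closed_A closed_cball)
  qed
  then show ?thesis using f by (simp add: Daugavet_point_def)
qed

text \<open>If no limit point of the Shilov boundary is a norming point of f, the norming points in the
  Shilov boundary form a finite set F, isolated in it; summing over F then gives a real functional
  separating f from its almost antipodal elements.\<close>

lemma limit_point_of_Delta_point:
  assumes f: "Delta_point A f"
  obtains t\<^sub>0 where "t\<^sub>0 islimpt shilov_boundary A" "norm (apply_bcontfun f t\<^sub>0) = 1"
proof (rule ccontr)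
  let ?\<Gamma> = "shilov_boundary A"
  assume "\<not> thesis"
  with that have no: "norm (apply_bcontfun f t) \<noteq> 1" if "t islimpt ?\<Gamma>" for t
    using that by blast
  have fA: "f \<in> A" "norm f = 1" using f by (auto simp: Delta_point_def)
  have f1: "norm (apply_bcontfun f t) \<le> 1" for t using norm_bounded[of f t] fA by simp
  define F where "F = {t \<in> ?\<Gamma>. norm (apply_bcontfun f t) = 1}"
  have "closed (?\<Gamma> \<inter> {t. norm (apply_bcontfun f t) = 1})"
    by (intro closed_Int closed_shilov closed_Collect_eq continuous_intros) auto
  then have "compact F" by (intro closed_imp_compact) (simp add: F_def Int_def)
  have "finite F"
  proof (rule ccontr)
    assume "infinite F"
    then obtain t where "t \<in> F" "t islimpt F"
      using Heine_Borel_imp_Bolzano_Weierstrass[OF \<open>compact F\<close>] by blast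
    then show False using no[of t] islimpt_subset[of t F ?\<Gamma>] by (auto simp: F_def)
  qed
  \<comment> \<open>No point of \<open>F\<close> is a limit point of the Shilov boundary, so
    removing \<open>F\<close> keeps it closed and |f| stays away from 1 on the rest.\<close>
  have "closed (?\<Gamma> - F)"
    unfolding closed_limpt
  proof (intro allI impI)
    fix t assume "t islimpt ?\<Gamma> - F"
    then have "t islimpt ?\<Gamma>" by (rule islimpt_subset) auto
    then show "t \<in> ?\<Gamma> - F" using no closed_shilov by (auto simp: closed_limpt F_def)
  qed
  then obtain b where b: "b < 1" "\<And>t. t \<in> ?\<Gamma> - F \<Longrightarrow> norm (apply_bcontfun f t) \<le> b"
    using compact_norm_bound_less_one[OF closed_imp_compact, of "?\<Gamma> - F" f] f1
    by (smt (verit, best) DiffE F_def mem_Collect_eq)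
  \<comment> \<open>\<epsilon> < 1 - b forces near-antipodal points into \<open>F\<close>, and
    \<epsilon> \<le> 1/2 gives (2 - \<epsilon>)^2 \<ge> 2.\<close>
  define \<epsilon> where "\<epsilon> = min (1/2) ((1 - b) / 2)"
  have \<epsilon>: "0 < \<epsilon>" "\<epsilon> \<le> 1/2" "\<epsilon> < 1 - b" using b(1) by (auto simp: \<epsilon>_def min_def)
  \<comment> \<open>Each summand is at most 1 on the unit ball, and all equal 1 for \<open>f\<close>
    itself.\<close>
  define \<Phi> where "\<Phi> y = (\<Sum>t\<in>F. inner (apply_bcontfun f t) (apply_bcontfun y t))"
    for y :: "'a \<Rightarrow>\<^sub>C complex"
  have \<Phi>: "bounded_linear \<Phi>"
    unfolding \<Phi>_def
    by (intro bounded_linear_sum bounded_linear_compose[OF bounded_linear_inner_right]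
        bounded_linear_apply_bcontfun)
  have small: "\<Phi> y \<le> real (card F) - 1" if y: "y \<in> Delta_set A \<epsilon> f" for y
  proof -
    have yA: "y \<in> A" "norm y \<le> 1" "2 - \<epsilon> \<le> norm (f - y)" using y by (auto simp: Delta_set_def)
    have y1: "norm (apply_bcontfun y t) \<le> 1" for t using norm_bounded[of y t] yA(2) by simp
    have in1: "inner (apply_bcontfun f t) (apply_bcontfun y t) \<le> 1" for t
      using norm_cauchy_schwarz[of "apply_bcontfun f t" "apply_bcontfun y t"]
        mult_mono[OF f1[of t] y1[of t]] by simp
    obtain t where t: "t \<in> ?\<Gamma>" "2 - \<epsilon> \<le> norm (apply_bcontfun f t - apply_bcontfun y t)"
      using boundary_shilov diff_in[OF fA(1) yA(1)] yA(3) unfolding boundary_for_def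
      by (metis minus_bcontfun.rep_eq)
    have "1 - \<epsilon> \<le> norm (apply_bcontfun f t)"
      using t(2) norm_triangle_ineq4[of "apply_bcontfun f t" "apply_bcontfun y t"] y1[of t] by simp
    then have tF: "t \<in> F" using b(2)[of t] t(1) \<epsilon>(3) by force
    \<comment> \<open>Polarisation turns the large distance at \<open>t\<close> into a nonpositive
      inner product, which costs the sum one full unit.\<close>
    have "(2 - \<epsilon>)\<^sup>2 \<le> (norm (apply_bcontfun f t - apply_bcontfun y t))\<^sup>2"
      using t(2) \<epsilon> by (intro power_mono) auto
    also have "\<dots> = (norm (apply_bcontfun f t))\<^sup>2 + (norm (apply_bcontfun y t))\<^sup>2
        - 2 * inner (apply_bcontfun f t) (apply_bcontfun y t)"
      by (simp add: power2_norm_eq_inner inner_diff_left inner_diff_right inner_commute)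
    also have "\<dots> \<le> 1 + 1 - 2 * inner (apply_bcontfun f t) (apply_bcontfun y t)"
      using f1[of t] y1[of t] by (intro diff_right_mono add_mono power_le_one) auto
    finally have "2 * inner (apply_bcontfun f t) (apply_bcontfun y t) \<le> 2 - (2 - \<epsilon>)\<^sup>2" by simp
    moreover have "2 \<le> (2 - \<epsilon>)\<^sup>2"
      using power_mono[of "3/2" "2 - \<epsilon>" 2] \<epsilon>(2) by (simp add: power2_eq_square)
    ultimately have in0: "inner (apply_bcontfun f t) (apply_bcontfun y t) \<le> 0" by simp
    have "\<Phi> y = inner (apply_bcontfun f t) (apply_bcontfun y t)
        + (\<Sum>s\<in>F - {t}. inner (apply_bcontfun f s) (apply_bcontfun y s))"
      unfolding \<Phi>_def using \<open>finite F\<close> tF by (rule sum.remove)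
    also have "\<dots> \<le> 0 + (\<Sum>s\<in>F - {t}. 1)"
      by (intro add_mono in0 sum_mono in1)
    also have "\<dots> = real (card F) - 1"
      using \<open>finite F\<close> tF by (simp add: card_Diff_singleton of_nat_diff Suc_leI card_gt_0_iff)
        (metis One_nat_def Suc_leI card_gt_0_iff empty_iff of_nat_1 of_nat_diff)
    finally show ?thesis .
  qed
  \<comment> \<open>This closed half-space contains the closed convex hull, hence \<open>f\<close>,
    although \<open>\<Phi> f\<close> is \<open>card F\<close>.\<close>
  have "convex {y. \<Phi> y \<le> real (card F) - 1}"
    using convex_linear_vimage[of \<Phi> "{..real (card F) - 1}"] \<Phi>
    by (simp add: vimage_def bounded_linear.linear)
  moreover have "closed {y. \<Phi> y \<le> real (card F) - 1}"
    by (intro closed_Collect_le continuous_intros linear_continuous_on \<Phi>)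
  ultimately have "closure (convex hull Delta_set A \<epsilon> f) \<subseteq> {y. \<Phi> y \<le> real (card F) - 1}"
    using small by (intro closure_minimal hull_minimal) auto
  then have "\<Phi> f \<le> real (card F) - 1"
    using f \<epsilon>(1) by (auto simp: Delta_point_def)
  moreover have "\<Phi> f = (\<Sum>t\<in>F. 1)"
    unfolding \<Phi>_def by (rule sum.cong) (auto simp: F_def power2_norm_eq_inner[symmetric])
  ultimately show False by simp
qed

end

theorem corollary5p5:
  fixes A :: "('a::t2_space \<Rightarrow>\<^sub>C complex) set"
    and f :: "'a \<Rightarrow>\<^sub>C complex"
  assumes "compact (UNIV :: 'a set)"
    and "uniform_algebra A"
    and "f \<in> A" and "norm f = 1"
  shows "(Daugavet_point A f \<longleftrightarrow> Delta_point A f) \<and>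
         (Delta_point A f \<longleftrightarrow>
            (\<exists>t\<^sub>0. t\<^sub>0 islimpt shilov_boundary A \<and> norm f = norm (apply_bcontfun f t\<^sub>0)))"
proof -
  interpret compact_uniform_algebra A
    using assms by unfold_locales
  have 1: "Delta_point A f" if "Daugavet_point A f"
    unfolding Delta_point_def
  proof (intro conjI allI impI)
    fix \<epsilon> :: real assume "0 < \<epsilon>"
    then have "{y \<in> A. norm y \<le> 1} = closure (convex hull Delta_set A \<epsilon> f)"
      using that by (simp add: Daugavet_point_def)
    moreover have "f \<in> {y \<in> A. norm y \<le> 1}"
      using assms by simp
    ultimately show "f \<in> closure (convex hull Delta_set A \<epsilon> f)" by blast
  qed (use assms in auto)
  have 2: "\<exists>t\<^sub>0. t\<^sub>0 islimpt shilov_boundary A \<and> norm f = norm (apply_bcontfun f t\<^sub>0)"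
    if "Delta_point A f"
    using limit_point_of_Delta_point[OF that] assms(4) by metis
  have 3: "Daugavet_point A f"
    if "\<exists>t\<^sub>0. t\<^sub>0 islimpt shilov_boundary A \<and> norm f = norm (apply_bcontfun f t\<^sub>0)"
    using that Daugavet_point_of_limit_point assms(3,4) by metis
  show ?thesis using 1 2 3 by blast
qed

end
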